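(* Let $\varphi\in\operatorname{LFM}(B_N)$ and suppose that $(\varphi,B_N)$ is conjugated to $(\psi,\mathbb{H}^N)$ with $$\psi(z,u,v,w)=\left(z+2i\langle u,a\rangle+2i\langle w,c\rangle+b,\;u+a,\;Dv,\;Aw\right),$$ where $D$ is a diagonal matrix with $\sigma(D)\subset\partial\mathbb{D}\setminus\{1\}$, and $A=\operatorname{diag}(\lambda_1,\dots,\lambda_r)$ with $0<|\lambda_j|<1$ for $j=1,\dots,r$. Let $\lambda_j=\exp(-u_j+iv_j)$ where $u_j>0$, $v_j\in[0,2\pi)$ for $j=1,\dots,r$, and $$\Theta=\operatorname{diag}\left(\frac{1}{2u_1}\frac{u_1^2+v_1^2}{|1-\lambda_1|^2},\dots,\frac{1}{2u_r}\frac{u_r^2+v_r^2}{|1-\lambda_r|^2}\right).$$ If $$\operatorname{Im}b-|a|^2\ge c^H\Theta c,$$ then $\varphi$ can be embedded into a semigroup on $B_N$.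
   Context: $B_N$ is the open unit ball of $\mathbb{C}^N$, $\mathbb{D}$ the open unit disc of $\mathbb{C}$, and $\mathbb{H}^N=\{(u_1,u')\in\mathbb{C}\times\mathbb{C}^{N-1}:\operatorname{Im}u_1>|u'|^2\}$ the Siegel half-plane, biholomorphic to $B_N$. $\langle x,y\rangle=y^Hx$, $^H$ is the conjugate transpose, $\sigma(\cdot)$ is the spectrum. In the formula for $\psi$, $(z,u,v,w)\in\mathbb{H}^N\subset\mathbb{C}\times\mathbb{C}^p\times\mathbb{C}^q\times\mathbb{C}^r$ with $1+p+q+r=N$, $b\in\mathbb{C}$, $a\in\mathbb{C}^p$, $c\in\mathbb{C}^r$, $D\in\mathbb{C}^{q\times q}$; some of the blocks $u,v,w$ may be absent. A holomorphic map is linear fractional if it has the form $z\mapsto \frac{Az+B}{\langle z,C\rangle+D}$ with $A\in\mathbb{C}^{N\times N}$, $B,C\in\mathbb{C}^N$, $D\in\mathbb{C}$; $\operatorname{LFM}(B_N)$ is the set of linear fractional self-maps of $B_N$. For holomorphic self-maps $\psi:D\to D$ and $\psi':D'\to D'$ of domains in $\mathbb{C}^N$, $(\psi,D)$ and $(\psi',D')$ are conjugated if there is a biholomorphic map $\sigma:D\to D'$ with $\psi=\sigma^{-1}\circ\psi'\circ\sigma$. A (continuous) semigroup $\{\varphi_t\}_{t\ge0}$ on a domain $D$ is a continuous homomorphism from the additive semigroup of non-negative reals into the composition semigroup of holomorphic self-maps of $D$ with the compact-open topology (so $\varphi_0=\mathrm{id}$, $\varphi_{t+s}=\varphi_t\circ\varphi_s$).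 A self-map $\varphi$ of $D$ can be embedded into a semigroup on $D$ if there is a semigroup $\{\varphi_t\}$ on $D$ with $\varphi_1=\varphi$. *)

theory Defs
  imports "HOL-Analysis.Analysis" "Jordan_Normal_Form.Spectral_Radius"
begin

unbundle no vec_syntax
notation vec_nth (infixl "$h" 90)

text \<open>
  The space \<open>C^N\<close> is \<^typ>\<open>complex^'n\<close>, with \<open>N = CARD('n)\<close>. The coefficient blocks in the
  sizes \<open>p\<close>, \<open>q\<close>, \<open>r\<close>, any of which may be 0, are carrier-based vectors and matrices.
\<close>

text \<open>\<open>\<langle>x,y\<rangle> = y^H x\<close>, linear in the first argument, as is \<open>\<bullet>c\<close> on carrier-based vectors.\<close>

definition hinner :: "complex^'n::finite \<Rightarrow> complex^'n \<Rightarrow> complex" where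
  "hinner x y = (\<Sum>i\<in>UNIV. x $h i * cnj (y $h i))"

text \<open>Holomorphic on an open set: real differentiable with complex-linear derivative, the
  latter being given by the complex Jacobian matrix \<open>J\<close>.\<close>

definition hol_on :: "(complex^'n::finite \<Rightarrow> complex^'n) \<Rightarrow> (complex^'n) set \<Rightarrow> bool" where
  "hol_on f S \<longleftrightarrow> (\<forall>x\<in>S. \<exists>J :: complex^'n^'n. (f has_derivative (\<lambda>h. J *v h)) (at x))"

definition hol_maps ::
  "(complex^'n::finite) set \<Rightarrow> (complex^'n) set \<Rightarrow> (complex^'n \<Rightarrow> complex^'n) set" where
  "hol_maps S T = {f. hol_on f S \<and> f ` S \<subseteq> T}"

definition biholomorphic ::
  "(complex^'n::finite \<Rightarrow> complex^'n) \<Rightarrow> (complex^'n) set \<Rightarrow> (complex^'n) set \<Rightarrow> bool" where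
  "biholomorphic \<sigma> S T \<longleftrightarrow> bij_betw \<sigma> S T \<and> hol_on \<sigma> S \<and> hol_on (inv_into S \<sigma>) T"

definition conjugated ::
  "(complex^'n::finite \<Rightarrow> complex^'n) \<Rightarrow> (complex^'n) set \<Rightarrow>
   (complex^'n \<Rightarrow> complex^'n) \<Rightarrow> (complex^'n) set \<Rightarrow> bool" where
  "conjugated \<phi> S \<psi> T \<longleftrightarrow> \<phi> \<in> hol_maps S S \<and> \<psi> \<in> hol_maps T T \<and>
     (\<exists>\<sigma>. biholomorphic \<sigma> S T \<and> (\<forall>x\<in>S. \<phi> x = inv_into S \<sigma> (\<psi> (\<sigma> x))))"

definition linear_fractional_on ::
  "(complex^'n::finite) set \<Rightarrow> (complex^'n \<Rightarrow> complex^'n) \<Rightarrow> bool" where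
  "linear_fractional_on S \<phi> \<longleftrightarrow>
     (\<exists>(A :: complex^'n^'n) (B :: complex^'n) (C :: complex^'n) (D :: complex). \<forall>x\<in>S.
        hinner x C + D \<noteq> 0 \<and> \<phi> x = inverse (hinner x C + D) *s (A *v x + B))"

definition LFM :: "(complex^'n::finite) set \<Rightarrow> (complex^'n \<Rightarrow> complex^'n) set" where
  "LFM S = {\<phi> \<in> hol_maps S S. linear_fractional_on S \<phi>}"

text \<open>The distinguished first coordinate is the one with index \<open>k\<close>.\<close>

definition siegel :: "'n \<Rightarrow> (complex^'n::finite) set" where
  "siegel k = {x. Im (x $h k) > (\<Sum>i\<in>UNIV - {k}. (cmod (x $h i))\<^sup>2)}"

text \<open>The splitting \<open>x = (z,u,v,w)\<close> of \<open>C^N\<close> into blocks of sizes \<open>1,p,q,r\<close>, the coordinates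
  of \<open>C^N\<close> being taken in the order \<open>e 0, \<dots>, e (N-1)\<close>.\<close>

definition blocks :: "(nat \<Rightarrow> 'n) \<Rightarrow> nat \<Rightarrow> nat \<Rightarrow> nat \<Rightarrow> complex^'n::finite \<Rightarrow>
    complex \<times> complex Matrix.vec \<times> complex Matrix.vec \<times> complex Matrix.vec" where
  "blocks e p q r x =
     (x $h e 0,
      Matrix.vec p (\<lambda>j. x $h e (1 + j)),
      Matrix.vec q (\<lambda>j. x $h e (1 + p + j)),
      Matrix.vec r (\<lambda>j. x $h e (1 + p + q + j)))"

text \<open>Maps are total functions, and maps agreeing on \<open>S\<close> are not identified; they are
  topologically indistinguishable here.\<close>

definition compact_open_topology ::
  "(complex^'n::finite) set \<Rightarrow> (complex^'n \<Rightarrow> complex^'n) topology" where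
  "compact_open_topology S = topology_generated_by
     {{f \<in> hol_maps S S. f ` K \<subseteq> U} | K U. compact K \<and> K \<subseteq> S \<and> open U}"

text \<open>The topological space of this topology is \<^term>\<open>hol_maps S S\<close>, so continuity includes
  that every \<open>\<Phi> t\<close> is a holomorphic self-map of \<open>S\<close>.\<close>

definition semigroup_on ::
  "(real \<Rightarrow> complex^'n::finite \<Rightarrow> complex^'n) \<Rightarrow> (complex^'n) set \<Rightarrow> bool" where
  "semigroup_on \<Phi> S \<longleftrightarrow>
     continuous_map (top_of_set {0..}) (compact_open_topology S) \<Phi> \<and>
     (\<forall>x\<in>S. \<Phi> 0 x = x) \<and>
     (\<forall>s\<ge>0. \<forall>t\<ge>0. \<forall>x\<in>S. \<Phi> (t + s) x = \<Phi> t (\<Phi> s x))"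

definition embeddable :: "(complex^'n::finite \<Rightarrow> complex^'n) \<Rightarrow> (complex^'n) set \<Rightarrow> bool" where
  "embeddable \<phi> S \<longleftrightarrow> (\<exists>\<Phi>. semigroup_on \<Phi> S \<and> (\<forall>x\<in>S. \<Phi> 1 x = \<phi> x))"

lemma topspace_compact_open_topology: "topspace (compact_open_topology S) = hol_maps S S"
proof -
  have "{f \<in> hol_maps S S. f ` {} \<subseteq> UNIV} \<in>
      {{f \<in> hol_maps S S. f ` K \<subseteq> U} | K U. compact K \<and> K \<subseteq> S \<and> open U}"
    by blast
  then show ?thesis
    unfolding compact_open_topology_def topology_generated_by_topspace by auto
qed

end

theory Submission
  imports Defs
begin

notation vec_lambda (binder "\<chi>" 10)

text \<open>
  On the Siegel half-plane the map \<open>\<psi>\<close> is the time-one map of an explicit affine flow: \<open>u\<close> is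
  translated along \<open>a\<close>, \<open>v\<close> and \<open>w\<close> are multiplied by \<open>D\<^sup>t\<close> and \<open>A\<^sup>t\<close>, and the coefficients in the
  first coordinate are forced by the semigroup law. The flow preserves the half-plane if the
  losses in the individual coordinates add up to at most \<open>t (Im b - |a|\<^sup>2)\<close>; for \<open>w\<^sub>j\<close>
  completing the square leaves the inequality
  \<open>|1 - exp (-t\<mu>)|\<^sup>2 / (1 - exp (-2t Re \<mu>)) \<le> t |\<mu>|\<^sup>2 / (2 Re \<mu>)\<close> with \<open>\<lambda>\<^sub>j = exp (-\<mu>)\<close>, and
  the right-hand side at \<open>t = 1\<close>, divided by \<open>|1 - \<lambda>\<^sub>j|\<^sup>2\<close>, is the entry of \<open>\<Theta>\<close>.
\<close>

section \<open>Holomorphic maps and semigroups\<close>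

lemma hol_on_imp_continuous_on: "hol_on f S \<Longrightarrow> continuous_on S f"
  unfolding hol_on_def
  by (meson continuous_at_imp_continuous_on has_derivative_continuous)

lemma hol_on_compose:
  assumes "hol_on f S" "hol_on g T" "f ` S \<subseteq> T"
  shows "hol_on (\<lambda>x. g (f x)) S"
  unfolding hol_on_def
proof
  fix x assume x: "x \<in> S"
  obtain J where J: "(f has_derivative (\<lambda>h. J *v h)) (at x)"
    using assms(1) x by (auto simp: hol_on_def)
  obtain K where K: "(g has_derivative (\<lambda>h. K *v h)) (at (f x))"
    using assms x by (fastforce simp: hol_on_def)
  have "((\<lambda>x. g (f x)) has_derivative (\<lambda>h. (K ** J) *v h)) (at x)"
    using has_derivative_compose[OF J K] by (simp add: matrix_vector_mul_assoc)
  then show "\<exists>J. ((\<lambda>x. g (f x)) has_derivative (\<lambda>h. J *v h)) (at x)" by blast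
qed

lemma hol_on_affine: "hol_on (\<lambda>x. M *v x + v) S"
  unfolding hol_on_def
proof
  fix x
  have "((\<lambda>x. M *v x + v) has_derivative (\<lambda>h. M *v h + 0)) (at x)"
    by (intro has_derivative_add has_derivative_const
        bounded_linear_imp_has_derivative matrix_vector_mul_bounded_linear)
  then show "\<exists>J. ((\<lambda>x. M *v x + v) has_derivative (\<lambda>h. J *v h)) (at x)" by auto
qed

text \<open>Joint continuity suffices by the tube lemma: the times at which some point of
  \<open>K\<close> leaves \<open>U\<close> form the projection, along the compact factor
  \<open>K\<close>, of a relatively closed subset of \<open>K \<times> I\<close>, hence a relatively
  closed set.\<close>

lemma continuous_map_compact_open_topology:
  fixes \<Phi> :: "'a::euclidean_space \<Rightarrow> complex^'n::finite \<Rightarrow> complex^'n"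
  assumes hol: "\<And>t. t \<in> I \<Longrightarrow> \<Phi> t \<in> hol_maps S S"
    and cont: "continuous_on (I \<times> S) (\<lambda>(t, x). \<Phi> t x)"
  shows "continuous_map (top_of_set I) (compact_open_topology S) \<Phi>"
  unfolding compact_open_topology_def
proof (rule continuous_on_generated_topo)
  fix W assume "W \<in> {{f \<in> hol_maps S S. f ` K \<subseteq> U} | K U. compact K \<and> K \<subseteq> S \<and> open U}"
  then obtain K U where W: "W = {f \<in> hol_maps S S. f ` K \<subseteq> U}"
    and K: "compact K" "K \<subseteq> S" and U: "open U" by blast
  let ?C = "K \<times> I \<inter> (\<lambda>z. \<Phi> (snd z) (fst z)) -` (- U)"
  have "continuous_on (K \<times> I) (\<lambda>z. (snd z, fst z))" by (intro continuous_intros)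
  from continuous_on_compose2[OF cont this] K(2)
  have "continuous_on (K \<times> I) (\<lambda>z. \<Phi> (snd z) (fst z))" by fastforce
  then have "closedin (top_of_set (K \<times> I)) ?C"
    using U by (intro continuous_closedin_preimage) auto
  from closedin_compact_projection[OF K(1) this]
  have "openin (top_of_set I) (I - {t. \<exists>x. x \<in> K \<and> (x, t) \<in> ?C})"
    by (rule openin_diff[OF openin_subtopology_self])
  moreover have "I - {t. \<exists>x. x \<in> K \<and> (x, t) \<in> ?C}
      = \<Phi> -` W \<inter> topspace (top_of_set I)"
    using hol by (auto simp: W)
  ultimately show "openin (top_of_set I) (\<Phi> -` W \<inter> topspace (top_of_set I))" by simp
next
  have "\<Phi> t \<in> topspace (compact_open_topology S)" if "t \<in> I" for t
    using hol that by (simp add: topspace_compact_open_topology)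
  then show "\<Phi> ` topspace (top_of_set I) \<subseteq>
      \<Union> {{f \<in> hol_maps S S. f ` K \<subseteq> U} | K U. compact K \<and> K \<subseteq> S \<and> open U}"
    unfolding compact_open_topology_def topology_generated_by_topspace by auto
qed

text \<open>Transport of structure: a jointly continuous flow on \<open>T\<close> through
  \<open>\<psi>\<close> is pulled back along \<open>\<sigma>\<close>. The semigroup law survives
  because the inner pair \<open>\<sigma>\<close>, \<open>\<tau>\<close> cancels, so the ball itself
  never has to be examined.\<close>

lemma embeddable_conjugate:
  fixes \<Psi> :: "real \<Rightarrow> complex^'n::finite \<Rightarrow> complex^'n"
  assumes bih: "biholomorphic \<sigma> S T"
    and \<phi>: "\<And>x. x \<in> S \<Longrightarrow> \<phi> x = inv_into S \<sigma> (\<psi> (\<sigma> x))"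
    and hol: "\<And>t. t \<ge> 0 \<Longrightarrow> \<Psi> t \<in> hol_maps T T"
    and cont: "continuous_on ({0..} \<times> T) (\<lambda>(t, y). \<Psi> t y)"
    and zero: "\<And>y. y \<in> T \<Longrightarrow> \<Psi> 0 y = y"
    and add: "\<And>s t y. s \<ge> 0 \<Longrightarrow> t \<ge> 0 \<Longrightarrow> y \<in> T \<Longrightarrow> \<Psi> (t + s) y = \<Psi> t (\<Psi> s y)"
    and one: "\<And>y. y \<in> T \<Longrightarrow> \<Psi> 1 y = \<psi> y"
  shows "embeddable \<phi> S"
proof -
  define \<tau> where "\<tau> = inv_into S \<sigma>"
  have bij: "bij_betw \<sigma> S T" and h\<sigma>: "hol_on \<sigma> S" and h\<tau>: "hol_on \<tau> T"
    using bih by (auto simp: biholomorphic_def \<tau>_def)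
  have \<sigma>S: "\<sigma> x \<in> T" if "x \<in> S" for x using bij that by (auto simp: bij_betw_def)
  have \<tau>T: "\<tau> y \<in> S" if "y \<in> T" for y
    using bij_betw_inv_into[OF bij] that by (auto simp: bij_betw_def \<tau>_def)
  have \<tau>\<sigma>: "\<tau> (\<sigma> x) = x" if "x \<in> S" for x
    using bij that by (simp add: \<tau>_def bij_betw_inv_into_left)
  have \<sigma>\<tau>: "\<sigma> (\<tau> y) = y" if "y \<in> T" for y
    using bij that by (simp add: \<tau>_def bij_betw_inv_into_right)
  have \<Psi>T: "\<Psi> t y \<in> T" if "t \<ge> 0" "y \<in> T" for t y
    using hol that by (fastforce simp: hol_maps_def)
  have h\<Psi>: "hol_on (\<Psi> t) T" if "t \<ge> 0" for t
    using hol that by (auto simp: hol_maps_def)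
  let ?\<Phi> = "\<lambda>t x. \<tau> (\<Psi> t (\<sigma> x))"
  have "?\<Phi> t \<in> hol_maps S S" if "t \<in> {0..}" for t
  proof -
    have "hol_on (\<lambda>x. \<Psi> t (\<sigma> x)) S"
      by (rule hol_on_compose[OF h\<sigma> h\<Psi>]) (use that \<sigma>S in auto)
    from hol_on_compose[OF this h\<tau>] have "hol_on (?\<Phi> t) S" using that \<sigma>S \<Psi>T by auto
    then show ?thesis using that \<sigma>S \<Psi>T \<tau>T by (auto simp: hol_maps_def)
  qed
  moreover have "continuous_on ({0..} \<times> S) (\<lambda>(t, x). ?\<Phi> t x)"
  proof -
    have "continuous_on ({0..} \<times> S) (\<lambda>z. \<sigma> (snd z))"
      by (rule continuous_on_compose2[OF hol_on_imp_continuous_on[OF h\<sigma>]])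
        (intro continuous_on_snd continuous_on_id, auto)
    then have c1: "continuous_on ({0..} \<times> S) (\<lambda>z. (fst z, \<sigma> (snd z)))"
      by (intro continuous_on_Pair continuous_on_fst continuous_on_id)
    have "(\<lambda>z. (fst z, \<sigma> (snd z))) ` ({0..} \<times> S) \<subseteq> {0..} \<times> T"
      using \<sigma>S by auto
    from continuous_on_compose2[OF cont c1 this]
    have c2: "continuous_on ({0..} \<times> S) (\<lambda>z. \<Psi> (fst z) (\<sigma> (snd z)))" by simp
    have "(\<lambda>z. \<Psi> (fst z) (\<sigma> (snd z))) ` ({0..} \<times> S) \<subseteq> T"
      using \<sigma>S \<Psi>T by auto
    from continuous_on_compose2[OF hol_on_imp_continuous_on[OF h\<tau>] c2 this]
    show ?thesis by (simp add: case_prod_unfold)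
  qed
  ultimately have "continuous_map (top_of_set {0..}) (compact_open_topology S) ?\<Phi>"
    by (rule continuous_map_compact_open_topology)
  then have "semigroup_on ?\<Phi> S"
    using \<sigma>S \<Psi>T by (auto simp: semigroup_on_def zero add \<tau>\<sigma> \<sigma>\<tau>)
  moreover have "\<forall>x\<in>S. ?\<Phi> 1 x = \<phi> x" using \<sigma>S by (simp add: \<phi> one \<tau>_def)
  ultimately show ?thesis unfolding embeddable_def by blast
qed

section \<open>Affine flows on the Siegel half-plane\<close>

text \<open>
  The exponents \<open>m\<close> are \<open>0\<close> on \<open>u\<close>, where only \<open>a\<close> acts; on \<open>v\<close> and \<open>w\<close> the translation \<open>a\<close> is
  \<open>0\<close>. The coefficient \<open>g\<close> matters only on \<open>w\<close>.
\<close>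

definition siegel_flow :: "'n \<Rightarrow> ('n::finite \<Rightarrow> complex) \<Rightarrow> ('n \<Rightarrow> complex) \<Rightarrow> ('n \<Rightarrow> complex) \<Rightarrow>
    complex \<Rightarrow> real \<Rightarrow> complex^'n \<Rightarrow> complex^'n" where
  "siegel_flow k m a g \<beta> t x = (\<chi> i. if i = k
     then x $h k + (\<Sum>j\<in>UNIV - {k}. (2 * \<i> * t * cnj (a j) + g j * (1 - exp (t * m j))) * x $h j
            + \<i> * t\<^sup>2 * (cmod (a j))\<^sup>2) + t * \<beta>
     else exp (t * m i) * x $h i + t * a i)"

lemma siegel_flow_nth:
  "i \<noteq> k \<Longrightarrow> siegel_flow k m a g \<beta> t x $h i = exp (t * m i) * x $h i + t * a i"
  "siegel_flow k m a g \<beta> t x $h k = x $h k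
    + (\<Sum>j\<in>UNIV - {k}. (2 * \<i> * t * cnj (a j) + g j * (1 - exp (t * m j))) * x $h j
        + \<i> * complex_of_real (t\<^sup>2) * complex_of_real ((cmod (a j))\<^sup>2)) + t * \<beta>"
  by (simp_all add: siegel_flow_def)

lemma siegel_flow_0: "siegel_flow k m a g \<beta> 0 x = x"
  by (simp add: siegel_flow_def Finite_Cartesian_Product.vec_eq_iff)

text \<open>Each coordinate is either a pure multiplication or a pure translation. In the first case
  the law is 1 - E(t+s) = (1 - E(s)) + E(s) (1 - E(t)) with E(t) = \<open>exp (t * m j)\<close>. In
  the second, the linear term evaluated at the shift \<open>s * a j\<close> yields 2i ts |a|^2, the
  cross term of i (t+s)^2 |a|^2.\<close>

lemma siegel_flow_add:
  assumes "\<And>i. i \<noteq> k \<Longrightarrow> a i = 0 \<or> m i = 0"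
  shows "siegel_flow k m a g \<beta> (t + s) x = siegel_flow k m a g \<beta> t (siegel_flow k m a g \<beta> s x)"
proof -
  have E: "exp (complex_of_real (t + s) * w) = exp (t * w) * exp (s * w)" for w :: complex
    by (simp add: ring_distribs exp_add)
  let ?L = "\<lambda>t j. 2 * \<i> * complex_of_real t * cnj (a j) + g j * (1 - exp (t * m j))"
  let ?Q = "\<lambda>t j. \<i> * complex_of_real (t\<^sup>2) * complex_of_real ((cmod (a j))\<^sup>2)"
  have *: "?L (t + s) j * x $h j + ?Q (t + s) j =
      (?L s j * x $h j + ?Q s j) + (?L t j * (exp (s * m j) * x $h j + s * a j) + ?Q t j)"
    if j: "j \<in> UNIV - {k}" for j
  proof -
    consider "a j = 0" | "m j = 0" using assms[of j] j by blast
    then show ?thesis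
    proof cases
      case 1
      then show ?thesis by (simp add: exp_add algebra_simps)
    next
      case 2
      have "complex_of_real ((cmod (a j))\<^sup>2) = a j * cnj (a j)"
        by (rule complex_norm_square)
      then show ?thesis using 2 by (simp add: power2_eq_square algebra_simps)
    qed
  qed
  show ?thesis
  proof (subst Finite_Cartesian_Product.vec_eq_iff, rule)
    fix i
    show "siegel_flow k m a g \<beta> (t + s) x $h i =
        siegel_flow k m a g \<beta> t (siegel_flow k m a g \<beta> s x) $h i"
    proof (cases "i = k")
      case True
      have "(\<Sum>j\<in>UNIV - {k}. ?L (t + s) j * x $h j + ?Q (t + s) j) =
          (\<Sum>j\<in>UNIV - {k}. ?L s j * x $h j + ?Q s j) +
          (\<Sum>j\<in>UNIV - {k}. ?L t j * (exp (s * m j) * x $h j + s * a j) + ?Q t j)"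
        unfolding sum.distrib[symmetric] by (rule sum.cong[OF refl]) (use * in blast)
      moreover have "(\<Sum>j\<in>UNIV - {k}. ?L t j * siegel_flow k m a g \<beta> s x $h j + ?Q t j) =
          (\<Sum>j\<in>UNIV - {k}. ?L t j * (exp (s * m j) * x $h j + s * a j) + ?Q t j)"
        by (intro sum.cong) (auto simp: siegel_flow_nth)
      ultimately show ?thesis unfolding True siegel_flow_nth(2)
        by (simp only: of_real_add distrib_right add_ac)
    next
      case False
      with assms have "a i = 0 \<or> m i = 0" by blast
      with False show ?thesis
        by (auto simp: siegel_flow_nth exp_add algebra_simps)
    qed
  qed
qed

lemma siegel_flow_affine: "\<exists>M v. siegel_flow k m a g \<beta> t = (\<lambda>x. M *v x + v)"
proof -
  let ?L = "\<lambda>j. 2 * \<i> * complex_of_real t * cnj (a j) + g j * (1 - exp (t * m j))"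
  let ?M = "\<chi> i j. if i = k then (if j = k then 1 else ?L j)
      else if j = i then exp (t * m i) else 0"
  let ?v = "\<chi> i. if i = k then (\<Sum>j\<in>UNIV - {k}. \<i> * t\<^sup>2 * (cmod (a j))\<^sup>2) + t * \<beta> else t * a i"
  have "siegel_flow k m a g \<beta> t x $h i = (?M *v x + ?v) $h i" for x i
  proof (cases "i = k")
    case True
    have "(?M *v x) $h i = (\<Sum>j\<in>UNIV. (if j = k then 1 else ?L j) * x $h j)"
      using True by (simp add: matrix_vector_mult_def)
    also have "\<dots> = x $h k + (\<Sum>j\<in>UNIV - {k}. ?L j * x $h j)"
      by (subst sum.remove[of _ k]) (auto intro: sum.cong)
    finally show ?thesis using True by (simp add: siegel_flow_def sum.distrib)
  next
    case False
    then show ?thesis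
      by (simp add: siegel_flow_def matrix_vector_mult_def if_distrib[of "\<lambda>y. y * _"] cong: if_cong)
  qed
  then have "siegel_flow k m a g \<beta> t = (\<lambda>x. ?M *v x + ?v)"
    by (simp add: fun_eq_iff Finite_Cartesian_Product.vec_eq_iff)
  then show ?thesis by blast
qed

lemma hol_on_siegel_flow: "hol_on (siegel_flow k m a g \<beta> t) S"
  using siegel_flow_affine[of k m a g \<beta> t] hol_on_affine by metis

lemma continuous_on_siegel_flow: "continuous_on S (\<lambda>(t, x). siegel_flow k m a g \<beta> t x)"
  unfolding siegel_flow_def case_prod_unfold
  proof (rule continuous_on_vec_lambda, goal_cases)
  case (1 i)
  show ?case by (cases "i = k") (simp_all, intro continuous_intros, intro continuous_intros)
qed

text \<open>Decouples invariance into one scalar inequality per coordinate: \<open>q i\<close> is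
  the rate at which coordinate \<open>i\<close> may draw on the growth \<open>Im \<beta>\<close> of
  the first coordinate. Strictness comes from \<open>x\<close> alone, so the individual inequalities
  need not be strict.\<close>

lemma siegel_flow_in_siegel:
  assumes x: "x \<in> siegel k"
    and q: "(\<Sum>i\<in>UNIV - {k}. q i) \<le> Im \<beta>" and t: "t \<ge> 0"
    and le: "\<And>i. i \<noteq> k \<Longrightarrow> (cmod (exp (t * m i) * x $h i + t * a i))\<^sup>2 \<le> (cmod (x $h i))\<^sup>2
      + Im ((2 * \<i> * t * cnj (a i) + g i * (1 - exp (t * m i))) * x $h i)
      + t\<^sup>2 * (cmod (a i))\<^sup>2 + t * q i"
  shows "siegel_flow k m a g \<beta> t x \<in> siegel k"
proof -
  let ?L = "\<lambda>i. (2 * \<i> * t * cnj (a i) + g i * (1 - exp (t * m i))) * x $h i"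
  have "(\<Sum>i\<in>UNIV - {k}. (cmod (siegel_flow k m a g \<beta> t x $h i))\<^sup>2)
      = (\<Sum>i\<in>UNIV - {k}. (cmod (exp (t * m i) * x $h i + t * a i))\<^sup>2)"
    by (intro sum.cong) (auto simp: siegel_flow_def)
  also have "\<dots> \<le> (\<Sum>i\<in>UNIV - {k}. (cmod (x $h i))\<^sup>2 + (Im (?L i) + t\<^sup>2 * (cmod (a i))\<^sup>2) + t * q i)"
    using le by (intro sum_mono) (auto simp: add.assoc)
  also have "\<dots> = (\<Sum>i\<in>UNIV - {k}. (cmod (x $h i))\<^sup>2)
      + (\<Sum>i\<in>UNIV - {k}. Im (?L i) + t\<^sup>2 * (cmod (a i))\<^sup>2) + t * (\<Sum>i\<in>UNIV - {k}. q i)"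
    by (simp only: sum.distrib sum_distrib_left)
  also have "\<dots> < Im (x $h k) + (\<Sum>i\<in>UNIV - {k}. Im (?L i) + t\<^sup>2 * (cmod (a i))\<^sup>2) + t * Im \<beta>"
    using x mult_left_mono[OF q t] by (simp add: siegel_def)
  also have "\<dots> = Im (siegel_flow k m a g \<beta> t x $h k)"
    by (simp add: siegel_flow_def flip: of_real_power)
  finally show ?thesis by (simp add: siegel_def)
qed

section \<open>The estimates in a single coordinate\<close>

text \<open>This is tanh(x/2) <= x/2 with the denominator cleared.\<close>

lemma one_minus_exp_neg_le:
  fixes x :: real
  assumes "x \<ge> 0"
  shows "1 - exp (- x) \<le> x * (1 + exp (- x)) / 2"
proof -
  let ?f = "\<lambda>x::real. x * (1 + exp (- x)) / 2 - (1 - exp (- x))"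
  have "?f 0 \<le> ?f x"
  proof (rule DERIV_nonneg_imp_nondecreasing[OF assms])
    fix y :: real assume "0 \<le> y" "y \<le> x"
    have "exp (- y) * (1 + y) \<le> exp (- y) * exp y"
      using exp_ge_add_one_self[of y] by (intro mult_left_mono) auto
    then have "exp (- y) * (1 + y) \<le> 1" by (simp add: exp_minus)
    moreover have "(?f has_real_derivative (1 - exp (- y) * (1 + y)) / 2) (at y)"
      by (auto intro!: derivative_eq_intros simp: field_simps)
    ultimately show "\<exists>d. (?f has_real_derivative d) (at y) \<and> d \<ge> 0" by force
  qed
  then show ?thesis by simp
qed

text \<open>This is x <= sinh x multiplied by 2 exp(-x).\<close>

lemma mult_exp_neg_le:
  fixes x :: real
  assumes "x \<ge> 0"
  shows "2 * x * exp (- x) \<le> 1 - exp (- 2 * x)"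
proof -
  let ?f = "\<lambda>x::real. 1 - exp (- 2 * x) - 2 * x * exp (- x)"
  have "?f 0 \<le> ?f x"
  proof (rule DERIV_nonneg_imp_nondecreasing[OF assms])
    fix y :: real assume "0 \<le> y" "y \<le> x"
    have "exp (- 2 * y) = exp (- y) * exp (- y)" by (simp flip: exp_add)
    then have "(?f has_real_derivative 2 * exp (- y) * (exp (- y) - (1 - y))) (at y)"
      by (auto intro!: derivative_eq_intros simp: algebra_simps)
    moreover have "exp (- y) - (1 - y) \<ge> 0" using exp_ge_add_one_self[of "- y"] by simp
    ultimately show "\<exists>d. (?f has_real_derivative d) (at y) \<and> d \<ge> 0"
      by (meson exp_ge_zero mult_nonneg_nonneg zero_le_numeral)
  qed
  then show ?thesis by simp
qed

lemma one_minus_cos_le: "2 * (1 - cos y) \<le> (y::real)\<^sup>2"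
proof -
  have "cos y = 1 - 2 * (sin (y / 2))\<^sup>2" using cos_double_sin[of "y / 2"] by simp
  moreover have "(sin (y / 2))\<^sup>2 \<le> (y / 2)\<^sup>2"
    using abs_sin_x_le_abs_x[of "y / 2"] by (rule abs_le_square_iff[THEN iffD1])
  ultimately show ?thesis by (simp add: power2_eq_square)
qed

text \<open>
  This is the Cauchy-Schwarz inequality for \<open>1 - exp m = - (\<integral>\<^sub>0\<^sup>1 m exp (s m) ds)\<close>, checked by
  elementary means after splitting off the contribution of \<open>Im m\<close>.
\<close>

lemma cmod_one_minus_exp_le:
  assumes "Re m \<le> 0"
  shows "2 * (- Re m) * (cmod (1 - exp m))\<^sup>2 \<le> (cmod m)\<^sup>2 * (1 - (cmod (exp m))\<^sup>2)"
proof -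
  define x y where "x = - Re m" and "y = Im m"
  have x: "x \<ge> 0" using assms by (simp add: x_def)
  have e2: "exp (- 2 * x) = (exp (- x))\<^sup>2" by (simp add: power2_eq_square flip: exp_add)
  have "(cmod (1 - exp m))\<^sup>2 = (1 - exp (- x) * cos y)\<^sup>2 + (exp (- x) * sin y)\<^sup>2"
    by (simp add: cmod_power2 Re_exp Im_exp x_def y_def)
  also have "\<dots> = 1 - 2 * exp (- x) * cos y + (exp (- x))\<^sup>2 * ((sin y)\<^sup>2 + (cos y)\<^sup>2)"
    unfolding distrib_left by (simp add: power2_diff power_mult_distrib)
  also have "\<dots> = (1 - exp (- x))\<^sup>2 + exp (- x) * (2 * (1 - cos y))"
    by (simp add: power2_eq_square algebra_simps)
  also have "\<dots> \<le> (1 - exp (- x))\<^sup>2 + exp (- x) * y\<^sup>2"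
    by (intro add_left_mono mult_left_mono one_minus_cos_le) simp
  finally have "2 * x * (cmod (1 - exp m))\<^sup>2 \<le> 2 * x * ((1 - exp (- x))\<^sup>2 + exp (- x) * y\<^sup>2)"
    using x by (intro mult_left_mono) auto
  also have "\<dots> = 2 * x * (1 - exp (- x)) * (1 - exp (- x)) + 2 * x * exp (- x) * y\<^sup>2"
    by (simp add: power2_eq_square algebra_simps)
  \<comment> \<open>The real and imaginary parts of \<open>m\<close> are now separate. The tanh
    bound turns the first term into x^2 (1 - exp(-x)) (1 + exp(-x)), the sinh bound handles the
    second, and both carry the common factor 1 - exp(-2x).\<close>
  also have "\<dots> \<le> 2 * x * (1 - exp (- x)) * (x * (1 + exp (- x)) / 2)
      + (1 - exp (- 2 * x)) * y\<^sup>2"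
    using x by (intro add_mono mult_left_mono mult_right_mono one_minus_exp_neg_le mult_exp_neg_le)
      auto
  also have "\<dots> = (x\<^sup>2 + y\<^sup>2) * (1 - (exp (- x))\<^sup>2)"
    unfolding e2 by (simp add: power2_eq_square field_simps)
  finally show ?thesis by (simp add: x_def y_def cmod_power2)
qed

text \<open>The contraction frees \<open>R\<close> and the budget supplies \<open>P\<close>;
  together they must absorb the linear term of modulus \<open>Y\<close>. The factor 1/4 in
  \<open>q\<close> makes the exponential estimate read Y^2 <= 4PR, and 4PR <= (P + R)^2
  finishes.\<close>

lemma contracting_coordinate_le:
  fixes m g w :: complex and t :: real
  assumes m: "Re m < 0" and t: "t \<ge> 0"
    and q: "q = (cmod g)\<^sup>2 / 4 * ((cmod m)\<^sup>2 / (2 * (- Re m)))"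
  shows "(cmod (exp (t * m) * w))\<^sup>2 \<le> (cmod w)\<^sup>2 + Im (g * (1 - exp (t * m)) * w) + t * q"
proof -
  let ?E = "exp (t * m)"
  define P where "P = t * q"
  define R where "R = (cmod w)\<^sup>2 * (1 - (cmod ?E)\<^sup>2)"
  define Y where "Y = cmod (g * (1 - ?E) * w)"
  have P: "P \<ge> 0" unfolding P_def q using m t
    by (intro mult_nonneg_nonneg divide_nonneg_pos) auto
  have "cmod ?E \<le> 1" using m t by (simp add: mult_nonneg_nonpos)
  then have R: "R \<ge> 0" unfolding R_def
    by (intro mult_nonneg_nonneg) (auto simp: power_le_one)
  have key: "(cmod (1 - ?E))\<^sup>2 \<le> t * (cmod m)\<^sup>2 / (2 * (- Re m)) * (1 - (cmod ?E)\<^sup>2)"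
  \<comment> \<open>The estimate for \<open>t * m\<close> has a factor t on the left and t^2 on the
    right; one t is cancelled, which requires t to be nonzero. At t = 0 both sides vanish.\<close>
  proof (cases "t = 0")
    case False
    with t have tp: "t > 0" by simp
    have "2 * (t * (- Re m)) * (cmod (1 - ?E))\<^sup>2 \<le> t\<^sup>2 * (cmod m)\<^sup>2 * (1 - (cmod ?E)\<^sup>2)"
      using cmod_one_minus_exp_le[of "t * m"] m t
      by (simp add: norm_mult power_mult_distrib mult_nonneg_nonpos)
    then have "t * (2 * (- Re m) * (cmod (1 - ?E))\<^sup>2) \<le> t * (t * (cmod m)\<^sup>2 * (1 - (cmod ?E)\<^sup>2))"
      by (simp add: power2_eq_square mult_ac)
    then have "2 * (- Re m) * (cmod (1 - ?E))\<^sup>2 \<le> t * (cmod m)\<^sup>2 * (1 - (cmod ?E)\<^sup>2)"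
      using tp by (simp only: mult_le_cancel_left_pos)
    moreover have "2 * (- Re m) > 0" using m by simp
    ultimately have "(cmod (1 - ?E))\<^sup>2 \<le> t * (cmod m)\<^sup>2 * (1 - (cmod ?E)\<^sup>2) / (2 * (- Re m))"
      by (subst pos_le_divide_eq) (simp_all only: mult.commute)
    then show ?thesis by (simp only: times_divide_eq_left)
  qed simp
  have "Y\<^sup>2 = (cmod g)\<^sup>2 * (cmod w)\<^sup>2 * (cmod (1 - ?E))\<^sup>2"
    by (simp add: Y_def norm_mult power_mult_distrib mult_ac)
  also have "\<dots> \<le> (cmod g)\<^sup>2 * (cmod w)\<^sup>2 * (t * (cmod m)\<^sup>2 / (2 * (- Re m)) * (1 - (cmod ?E)\<^sup>2))"
    by (intro mult_left_mono key) auto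
  also have "\<dots> = 4 * P * R" by (simp add: P_def R_def q)
  also have "\<dots> \<le> (P + R)\<^sup>2"
    using zero_le_power2[of "P - R"] by (simp add: power2_eq_square algebra_simps)
  finally have "Y \<le> P + R" using P R by (intro power2_le_imp_le[of Y]) auto
  moreover have "- Y \<le> Im (g * (1 - ?E) * w)"
    unfolding Y_def using abs_Im_le_cmod abs_le_D2 by (smt (verit))
  ultimately have "0 \<le> P + R + Im (g * (1 - ?E) * w)" by linarith
  then show ?thesis
    by (simp add: P_def R_def norm_mult power_mult_distrib right_diff_distrib mult.commute)
qed

section \<open>Diagonal entries as eigenvalues, and sums split along the blocks\<close>

lemma diagonal_entry_in_spectrum:
  fixes D :: "complex Matrix.mat"
  assumes D: "D \<in> carrier_mat q q" "diagonal_mat D" and j: "j < q"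
  shows "D $$ (j, j) \<in> spectrum D"
proof -
  \<comment> \<open>The characteristic polynomial of a triangular matrix is the product of X - d
    over its diagonal entries d, so each of them is a root.\<close>
  have "upper_triangular D"
    using D by (auto simp: diagonal_mat_def upper_triangular_def)
  then have "eigenvalue D (D $$ (j, j))"
    using eigenvalue_root_char_poly[OF D(1)] char_poly_upper_triangular[OF D(1)] D(1) j
    by (auto simp: poly_prod_list prod_list_zero_iff diag_mat_def)
  then show ?thesis by (simp add: spectrum_def)
qed

lemma sum_lessThan_blocks:
  fixes f :: "nat \<Rightarrow> 'a::comm_monoid_add"
  shows "(\<Sum>i\<in>{1..<1 + p + q + r}. f i) =
    (\<Sum>j<p. f (Suc j)) + (\<Sum>j<q. f (Suc (p + j))) + (\<Sum>j<r. f (Suc (p + q + j)))"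
proof -
  have shift: "(\<Sum>i\<in>{m..<m + n}. f i) = (\<Sum>j<n. f (m + j))" for m n
    using sum.shift_bounds_nat_ivl[of f 0 m n] by (simp add: add.commute atLeast0LessThan)
  have "(\<Sum>i\<in>{1..<1 + p + q + r}. f i)
      = (\<Sum>i\<in>{1..<1 + p}. f i) + (\<Sum>i\<in>{1 + p..<1 + p + q}. f i)
        + (\<Sum>i\<in>{1 + p + q..<1 + p + q + r}. f i)"
    using sum.atLeastLessThan_concat[of 1 "1 + p" "1 + p + q" f]
      sum.atLeastLessThan_concat[of 1 "1 + p + q" "1 + p + q + r" f]
    by (simp del: sum.op_ivl_Suc)
  also have "\<dots> = (\<Sum>j<p. f (Suc j)) + (\<Sum>j<q. f (Suc (p + j))) + (\<Sum>j<r. f (Suc (p + q + j)))"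
    unfolding shift by simp
  finally show ?thesis .
qed

theorem theorem1p8:
  fixes \<phi> \<psi> :: "complex^'n::finite \<Rightarrow> complex^'n"
    and e :: "nat \<Rightarrow> 'n" and p q r :: nat
    and a c :: "complex Matrix.vec" and b :: complex
    and D A \<Theta> :: "complex Matrix.mat"
    and lam :: "nat \<Rightarrow> complex" and \<alpha> \<beta> :: "nat \<Rightarrow> real"
  assumes "CARD('n) = 1 + p + q + r"
    and "bij_betw e {..<CARD('n)} UNIV"
    and "a \<in> carrier_vec p" and "c \<in> carrier_vec r"
    and "D \<in> carrier_mat q q" and "diagonal_mat D" and "spectrum D \<subseteq> sphere 0 1 - {1}"
    and "A = mat_diag r lam"
    and "\<And>j. j < r \<Longrightarrow> 0 < cmod (lam j) \<and> cmod (lam j) < 1"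
    and "\<phi> \<in> LFM (ball 0 1)"
    and "conjugated \<phi> (ball 0 1) \<psi> (siegel (e 0))"
    and "\<And>x. x \<in> siegel (e 0) \<Longrightarrow>
      blocks e p q r (\<psi> x) = (case blocks e p q r x of (z, u, v, w) \<Rightarrow>
        (z + 2 * \<i> * (u \<bullet>c a) + 2 * \<i> * (w \<bullet>c c) + b, u + a, D *\<^sub>v v, A *\<^sub>v w))"
    and "\<And>j. j < r \<Longrightarrow> lam j = exp (- complex_of_real (\<alpha> j) + \<i> * complex_of_real (\<beta> j))
      \<and> \<alpha> j > 0 \<and> \<beta> j \<in> {0..<2 * pi}"
    and "\<Theta> = mat_diag r (\<lambda>j. complex_of_real
      (1 / (2 * \<alpha> j) * (((\<alpha> j)\<^sup>2 + (\<beta> j)\<^sup>2) / (cmod (1 - lam j))\<^sup>2)))"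
    and "Im b - (\<Sum>j<p. (cmod (vec_index a j))\<^sup>2) \<ge> Re ((\<Theta> *\<^sub>v c) \<bullet>c c)"
  shows "embeddable \<phi> (ball 0 1)"
proof -
  note assms(1)[simp] and e = assms(2) and a = assms(3) and c = assms(4) and D = assms(5-7)
    and A = assms(8) and conj = assms(11) and \<psi> = assms(12) and lam = assms(13)
    and \<Theta> = assms(14) and le = assms(15)
  let ?S = "siegel (e 0)"
  define idx where "idx = inv_into {..<CARD('n)} e"
  have idx[simp]: "idx (e j) = j" if "j < 1 + p + q + r" for j
    unfolding idx_def using e that by (intro bij_betw_inv_into_left[of _ _ UNIV]) auto
  have e0: "e j \<noteq> e 0" if "0 < j" "j < 1 + p + q + r" for j
  proof
    assume "e j = e 0"
    from arg_cong[OF this, of idx] show False using that by simp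
  qed
  have e_cases: "i = e 0 \<or> (\<exists>j<p. i = e (Suc j)) \<or> (\<exists>j<q. i = e (Suc (p + j)))
      \<or> (\<exists>j<r. i = e (Suc (p + q + j)))" for i
  proof -
    obtain n where n: "n < 1 + p + q + r" "i = e n"
      using e by (auto simp: bij_betw_def)
    consider "n = 0" | j where "j < p" "n = Suc j" | j where "j < q" "n = Suc (p + j)"
      | j where "j < r" "n = Suc (p + q + j)"
    proof -
      have "n = 0 \<or> (n - 1 < p \<and> n = Suc (n - 1)) \<or> (n - (1 + p) < q \<and> n = Suc (p + (n - (1 + p))))
        \<or> (n - (1 + p + q) < r \<and> n = Suc (p + q + (n - (1 + p + q))))"
        using n(1) by linarith
      then show thesis using that by blast
    qed
    then show ?thesis using n(2) by cases auto
  qed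
  have sum_e: "(\<Sum>i\<in>UNIV - {e 0}. f i) = (\<Sum>j<p. f (e (Suc j))) + (\<Sum>j<q. f (e (Suc (p + j))))
      + (\<Sum>j<r. f (e (Suc (p + q + j))))" for f :: "'n \<Rightarrow> 'b::comm_monoid_add"
  proof -
    have "bij_betw e ({..<1 + p + q + r} - {0}) (UNIV - {e 0})"
      using bij_betw_DiffI[OF e, of "{0}" "{e 0}"] by simp
    moreover have "{..<1 + p + q + r} - {0} = {1..<1 + p + q + r}" by auto
    ultimately have "(\<Sum>i\<in>UNIV - {e 0}. f i) = (\<Sum>n\<in>{1..<1 + p + q + r}. f (e n))"
      by (metis sum.reindex_bij_betw)
    then show ?thesis by (simp only: sum_lessThan_blocks)
  qed

  \<comment> \<open>The data of the flow\<close>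
  define \<mu> where "\<mu> j = - complex_of_real (\<alpha> j) + \<i> * complex_of_real (\<beta> j)" for j
  \<comment> \<open>\<open>w j\<close> is the diagonal entry of \<Theta>. It depends on the branch
    of the logarithm, so \<open>\<mu> j\<close> keeps the prescribed argument
    \<open>\<beta> j\<close> instead of being \<open>Ln (lam j)\<close>. Here \<open>\<mu> j\<close>
    is the exponent itself, with real part \<open>- \<alpha> j\<close>.\<close>
  define w where "w j = 1 / (2 * \<alpha> j) * (((\<alpha> j)\<^sup>2 + (\<beta> j)\<^sup>2) / (cmod (1 - lam j))\<^sup>2)" for j
  define m where "m i = (if idx i < 1 + p then 0
    else if idx i < 1 + p + q then Ln (D $$ (idx i - (1 + p), idx i - (1 + p)))
    else \<mu> (idx i - (1 + p + q)))" for i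
  \<comment> \<open>At position 0 the truncated subtraction gives an arbitrary value, which the flow
    never reads; \<open>m\<close> is 0 there, as the semigroup law asks.\<close>
  define a' where "a' i = (if idx i < 1 + p then vec_index a (idx i - 1) else 0)" for i
  \<comment> \<open>Solves \<open>g i * (1 - lam j) = 2 * \<i> * cnj (vec_index c j)\<close>, so
    that the time-one map has the linear coefficient of \<psi>.\<close>
  define g where "g i = (if idx i < 1 + p + q then 0
    else 2 * \<i> * cnj (vec_index c (idx i - (1 + p + q))) / (1 - lam (idx i - (1 + p + q))))" for i
  \<comment> \<open>The budget of each coordinate; the sum of all of them is c^H \<Theta> c.\<close>
  define \<kappa> where "\<kappa> i = (if idx i < 1 + p + q then 0
    else w (idx i - (1 + p + q)) * (cmod (vec_index c (idx i - (1 + p + q))))\<^sup>2)" for i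
  \<comment> \<open>At time one the quadratic terms of the flow add i |a|^2, which is removed here.
    Hence Im b' = Im b - |a|^2, the left side of the hypothesis.\<close>
  define b' where "b' = b - \<i> * (\<Sum>j<p. (cmod (vec_index a j))\<^sup>2)"
  have u: "m (e (Suc j)) = 0" "a' (e (Suc j)) = vec_index a j" "g (e (Suc j)) = 0"
    "\<kappa> (e (Suc j)) = 0" if "j < p" for j
    using that by (auto simp: m_def a'_def g_def \<kappa>_def)
  have v: "m (e (Suc (p + j))) = Ln (D $$ (j, j))" "a' (e (Suc (p + j))) = 0"
    "g (e (Suc (p + j))) = 0" "\<kappa> (e (Suc (p + j))) = 0" if "j < q" for j
    using that by (auto simp: m_def a'_def g_def \<kappa>_def)
  have w: "m (e (Suc (p + q + j))) = \<mu> j" "a' (e (Suc (p + q + j))) = 0"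
    "g (e (Suc (p + q + j))) = 2 * \<i> * cnj (vec_index c j) / (1 - lam j)"
    "\<kappa> (e (Suc (p + q + j))) = w j * (cmod (vec_index c j))\<^sup>2" if "j < r" for j
    using that by (auto simp: m_def a'_def g_def \<kappa>_def)
  have D1: "cmod (D $$ (j, j)) = 1" if "j < q" for j
    using diagonal_entry_in_spectrum[OF D(1,2) that] D(3) by auto
  have lam1: "lam j \<noteq> 1" if "j < r" for j
    using assms(9)[OF that] by auto
  have lam\<mu>: "exp (\<mu> j) = lam j" and \<alpha>: "\<alpha> j > 0" if "j < r" for j
    using lam[OF that] by (simp_all add: \<mu>_def)
  define F where "F = siegel_flow (e 0) m a' g b'"

  obtain \<sigma> where bih: "biholomorphic \<sigma> (ball 0 1) ?S"
    and \<sigma>: "\<And>x. x \<in> ball 0 1 \<Longrightarrow> \<phi> x = inv_into (ball 0 1) \<sigma> (\<psi> (\<sigma> x))"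
    using conj by (auto simp: conjugated_def)
  show ?thesis
  proof (rule embeddable_conjugate[of \<sigma> _ ?S \<phi> \<psi> F, OF bih \<sigma>])

    \<comment> \<open>Invariance of the half-plane\<close>
    fix t :: real assume t: "t \<ge> 0"
    have \<Theta>w: "\<Theta> = mat_diag r (\<lambda>j. complex_of_real (w j))"
      by (simp only: \<Theta> w_def)
    have "(\<Theta> *\<^sub>v c) \<bullet>c c = (\<Sum>j<r. complex_of_real (w j * (cmod (vec_index c j))\<^sup>2))"
    proof -
      have "vec_index (\<Theta> *\<^sub>v c) j = w j * vec_index c j" if "j < r" for j
      proof -
        have "vec_index (\<Theta> *\<^sub>v c) j
            = (\<Sum>l\<in>{0..<r}. (if j = l then complex_of_real (w l) else 0) * vec_index c l)"
          using that c by (simp add: \<Theta>w mat_diag_def scalar_prod_def)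
        also have "\<dots> = (\<Sum>l\<in>{0..<r}. if j = l then complex_of_real (w l) * vec_index c l else 0)"
          by (intro sum.cong) auto
        finally show ?thesis using that by simp
      qed
      moreover have "vec_index c j * cnj (vec_index c j) = complex_of_real ((cmod (vec_index c j))\<^sup>2)" for j
        by (rule complex_norm_square[symmetric])
      ultimately show ?thesis using c
        by (simp add: scalar_prod_def atLeast0LessThan mult.assoc)
    qed
    then have "(\<Sum>i\<in>UNIV - {e 0}. \<kappa> i) \<le> Im b'"
      using le unfolding sum_e by (simp add: u v w b'_def cong: sum.cong_simp)
    moreover have "(cmod (exp (t * m i) * x $h i + t * a' i))\<^sup>2 \<le> (cmod (x $h i))\<^sup>2
        + Im ((2 * \<i> * t * cnj (a' i) + g i * (1 - exp (t * m i))) * x $h i)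
        + t\<^sup>2 * (cmod (a' i))\<^sup>2 + t * \<kappa> i" if "i \<noteq> e 0" for i x
    proof -
      consider j where "j < p" "i = e (Suc j)" | j where "j < q" "i = e (Suc (p + j))"
        | j where "j < r" "i = e (Suc (p + q + j))"
        using e_cases[of i] \<open>i \<noteq> e 0\<close> by blast
      then show ?thesis
      proof cases
        case (1 j)
        \<comment> \<open>Translations satisfy the coordinate inequality with equality, so they need
          no budget.\<close>
        have "(cmod (y + t * z))\<^sup>2 = (cmod y)\<^sup>2 + Im (2 * \<i> * t * cnj z * y) + t\<^sup>2 * (cmod z)\<^sup>2"
          for y z :: complex
          unfolding cmod_power2 by (simp add: power2_eq_square algebra_simps)
        then show ?thesis unfolding 1(2) by (simp only: u[OF 1(1)]) simp
      next
        case (2 j)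
        \<comment> \<open>The logarithm of a number of modulus one is purely imaginary, so this
          coordinate only rotates.\<close>
        have "D $$ (j, j) \<noteq> 0" using D1[OF 2(1)] by auto
        then have "cmod (exp (t * Ln (D $$ (j, j)))) = 1" using D1[OF 2(1)] by simp
        then have "(cmod (exp (t * Ln (D $$ (j, j))) * x $h i))\<^sup>2 = (cmod (x $h i))\<^sup>2"
          by (simp only: norm_mult mult_1)
        then show ?thesis unfolding 2(2) v[OF 2(1)] by simp
      next
        case (3 j)
        have "(cmod (exp (t * \<mu> j) * x $h i))\<^sup>2 \<le> (cmod (x $h i))\<^sup>2
            + Im (g i * (1 - exp (t * \<mu> j)) * x $h i) + t * \<kappa> i"
        proof (rule contracting_coordinate_le[OF _ t])
          have \<mu>: "(cmod (\<mu> j))\<^sup>2 = (\<alpha> j)\<^sup>2 + (\<beta> j)\<^sup>2" "Re (\<mu> j) = - \<alpha> j"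
            by (simp_all add: \<mu>_def cmod_power2)
          show "Re (\<mu> j) < 0" using \<alpha>[OF 3(1)] by (simp add: \<mu>_def)
          \<comment> \<open>Since |g|^2 / 4 = |c_j|^2 / |1 - lam j|^2, the budget required by the
            estimate is exactly the \<Theta>-entry times |c_j|^2.\<close>
          show "\<kappa> i = (cmod (g i))\<^sup>2 / 4 * ((cmod (\<mu> j))\<^sup>2 / (2 * - Re (\<mu> j)))"
            unfolding 3(2) w[OF 3(1)] \<mu>
            by (simp add: w_def norm_mult norm_divide power_divide power_mult_distrib mult.commute)
        qed
        then show ?thesis unfolding 3(2) w[OF 3(1)] by simp
      qed
    qed
    ultimately have "F t x \<in> ?S" if "x \<in> ?S" for x
      unfolding F_def using t that by (intro siegel_flow_in_siegel[where q = \<kappa>]) auto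
    then show "F t \<in> hol_maps ?S ?S"
      by (auto simp: hol_maps_def F_def hol_on_siegel_flow)
  next
    show "continuous_on ({0..} \<times> ?S) (\<lambda>(t, y). F t y)"
      unfolding F_def by (rule continuous_on_siegel_flow)
  next
    show "F 0 y = y" for y by (simp add: F_def siegel_flow_0)
  next
    fix s t :: real and y
    have "a' i = 0 \<or> m i = 0" for i by (simp add: a'_def m_def)
    then show "F (t + s) y = F t (F s y)"
      unfolding F_def by (intro siegel_flow_add)
  next

    \<comment> \<open>The time-one map\<close>
    fix x assume x: "x \<in> ?S"
    have \<psi>0: "\<psi> x $h e 0 = x $h e 0 + 2 * \<i> * (\<Sum>j<p. x $h e (Suc j) * cnj (vec_index a j))
        + 2 * \<i> * (\<Sum>j<r. x $h e (Suc (p + q + j)) * cnj (vec_index c j)) + b"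
      using \<psi>[OF x] a c by (simp add: blocks_def scalar_prod_def atLeast0LessThan)
    have \<psi>u: "\<psi> x $h e (Suc j) = x $h e (Suc j) + vec_index a j" if "j < p" for j
    proof -
      have "Matrix.vec p (\<lambda>j. \<psi> x $h e (Suc j)) = Matrix.vec p (\<lambda>j. x $h e (Suc j)) + a"
        using \<psi>[OF x] by (simp add: blocks_def)
      from arg_cong[OF this, of "\<lambda>y. vec_index y j"] show ?thesis using that a by simp
    qed
    have \<psi>v: "\<psi> x $h e (Suc (p + j)) = D $$ (j, j) * x $h e (Suc (p + j))" if "j < q" for j
    proof -
      have "Matrix.vec q (\<lambda>j. \<psi> x $h e (Suc (p + j))) = D *\<^sub>v Matrix.vec q (\<lambda>j. x $h e (Suc (p + j)))"
        using \<psi>[OF x] by (simp add: blocks_def)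
      from arg_cong[OF this, of "\<lambda>y. vec_index y j"]
      have "\<psi> x $h e (Suc (p + j)) = (\<Sum>l\<in>{0..<q}. D $$ (j, l) * x $h e (Suc (p + l)))"
        using that D(1) by (simp add: scalar_prod_def)
      also have "\<dots> = (\<Sum>l\<in>{0..<q}. if j = l then D $$ (j, j) * x $h e (Suc (p + j)) else 0)"
        using D(1,2) that by (intro sum.cong) (auto simp: diagonal_mat_def)
      finally show ?thesis using that by simp
    qed
    have \<psi>w: "\<psi> x $h e (Suc (p + q + j)) = lam j * x $h e (Suc (p + q + j))" if "j < r" for j
    proof -
      have "Matrix.vec r (\<lambda>j. \<psi> x $h e (Suc (p + q + j)))
          = A *\<^sub>v Matrix.vec r (\<lambda>j. x $h e (Suc (p + q + j)))"
        using \<psi>[OF x] by (simp add: blocks_def)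
      from arg_cong[OF this, of "\<lambda>y. vec_index y j"]
      have "\<psi> x $h e (Suc (p + q + j))
          = (\<Sum>l\<in>{0..<r}. (if j = l then lam l else 0) * x $h e (Suc (p + q + l)))"
        using that by (simp add: scalar_prod_def A mat_diag_def)
      also have "\<dots> = (\<Sum>l\<in>{0..<r}. if j = l then lam j * x $h e (Suc (p + q + j)) else 0)"
        by (intro sum.cong) auto
      finally show ?thesis using that by simp
    qed
    have "F 1 x $h i = \<psi> x $h i" for i
    proof -
      consider "i = e 0" | j where "j < p" "i = e (Suc j)" | j where "j < q" "i = e (Suc (p + j))"
        | j where "j < r" "i = e (Suc (p + q + j))"
        using e_cases[of i] by blast
      then show ?thesis
      proof cases
        case 1
        \<comment> \<open>The summand of the first coordinate at time 1, left unsimplified to match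
          the flow formula. The \<open>u\<close> block gives the linear term in \<open>a\<close> and
          the i |a|^2 that \<open>b'\<close> cancels, the \<open>v\<close> block gives nothing, and
          the \<open>w\<close> block gives the linear term in \<open>c\<close>.\<close>
        let ?T = "\<lambda>i. (2 * \<i> * complex_of_real 1 * cnj (a' i)
          + g i * (1 - exp (complex_of_real 1 * m i))) * x $h i
          + \<i> * complex_of_real (1\<^sup>2) * complex_of_real ((cmod (a' i))\<^sup>2)"
        have "(\<Sum>j<p. ?T (e (Suc j))) = (\<Sum>j<p. 2 * \<i> * (x $h e (Suc j) * cnj (vec_index a j))
            + \<i> * complex_of_real ((cmod (vec_index a j))\<^sup>2))"
          by (intro sum.cong refl) (simp add: u)
        moreover have "(\<Sum>j<q. ?T (e (Suc (p + j)))) = 0"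
          by (intro sum.neutral ballI) (simp add: v)
        moreover have "(\<Sum>j<r. ?T (e (Suc (p + q + j))))
            = (\<Sum>j<r. 2 * \<i> * (x $h e (Suc (p + q + j)) * cnj (vec_index c j)))"
          using lam1 by (intro sum.cong refl) (simp add: w lam\<mu>)
        ultimately show ?thesis unfolding 1 \<psi>0 F_def siegel_flow_nth(2) sum_e
          by (simp add: b'_def sum.distrib sum_distrib_left)
      next
        case (2 j)
        then show ?thesis unfolding 2(2) \<psi>u[OF 2(1)]
          using e0[of "Suc j"] u[OF 2(1)] by (simp add: F_def siegel_flow_def)
      next
        case (3 j)
        have "D $$ (j, j) \<noteq> 0" using D1[OF 3(1)] by auto
        then show ?thesis unfolding 3(2) \<psi>v[OF 3(1)]
          using e0[of "Suc (p + j)"] v[OF 3(1)] 3(1) by (simp add: F_def siegel_flow_def)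
      next
        case (4 j)
        then show ?thesis unfolding 4(2) \<psi>w[OF 4(1)]
          using e0[of "Suc (p + q + j)"] w[OF 4(1)] lam\<mu>[OF 4(1)]
          by (simp add: F_def siegel_flow_def)
      qed
    qed
    then show "F 1 x = \<psi> x" by (simp add: Finite_Cartesian_Product.vec_eq_iff)
  qed
qed

end
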